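(* Let $r\geq 3$ and let $H$ be an $r$-uniform hypergraph with $E(H)\neq\emptyset$. Then there exists a vertex $u$ in $H$ such that $$\rho(H)\leq\rho(H^{(2)})^{r-1}\lambda(H(u)).$$ Moreover, for an $(r-1)$-uniform hypergraph $F$, $K_1\ast F$ is a subhypergraph of $H$ if one of the following holds: (1) $(r-1)!\,\rho(H)>\rho(H^{(2)})^{r-1}\pi_\lambda(F)$. (2) $r!\,|E(H)|>|V(H)|\,\rho(H^{(2)})^{r-1}\pi_\lambda(F)$. (3) $(r-1)!\,\rho(H)>\Delta(H^{(2)})^{r-1}\pi_\lambda(F)$.
   Context: A (finite) hypergraph $H$ with vertex set $V(H)$ and edge set $E(H)$ is $k$-uniform if each edge consists of exactly $k$ distinct vertices; a graph is a $2$-uniform hypergraph. A hypergraph $H_0$ is a subhypergraph of $H$ if $V(H_0)\subseteq V(H)$ and $E(H_0)\subseteq E(H)$ ("$F$ is a subhypergraph of $H$" is understood up to isomorphism, and $H$ is $F$-free if it has no subhypergraph isomorphic to $F$). The adjacency tensor of a $k$-uniform hypergraph $H$ is the $k$-order $|V(H)|$-dimension tensor $\mathcal{A}_H=(a_{i_1\cdots i_k})$ with $a_{i_1\cdots i_k}=\frac{1}{(k-1)!}$ if $\{i_1,\ldots,i_k\}\in E(H)$ and $0$ otherwise. For an $m$-order $n$-dimension tensor $\mathcal{A}=(a_{i_1\cdots i_m})$ and $x\in\mathbb{C}^n$, $\mathcal{A}x^{m-1}\in\mathbb{C}^n$ is the vector with $i$-th component $\sum_{i_2,\ldots,i_m=1}^n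 a_{ii_2\cdots i_m}x_{i_2}\cdots x_{i_m}$. A number $\lambda\in\mathbb{C}$ is an eigenvalue of $\mathcal{A}$ if $\mathcal{A}x^{m-1}=\lambda x^{[m-1]}$ for some nonzero $x\in\mathbb{C}^n$, where $x^{[m-1]}=(x_1^{m-1},\ldots,x_n^{m-1})^\top$. The spectral radius of $\mathcal{A}$ is the largest modulus of its eigenvalues, and $\rho(H)$ is the spectral radius of $\mathcal{A}_H$ (for a graph, the spectral radius of its adjacency matrix). The 2-section graph $H^{(2)}$ of $H$ is the graph on $V(H)$ in which distinct $u,v$ are adjacent if and only if $\{u,v\}\subseteq e$ for some $e\in E(H)$; $\Delta(H^{(2)})$ is its maximum degree. For a vertex $u$ of $H$, $N(u)$ is the set of neighbors of $u$ in $H^{(2)}$, and $H(u)$ is the $(r-1)$-uniform hypergraph with vertex set $N(u)$ and edge set $\{e\setminus\{u\}: u\in e\in E(H)\}$. The Lagrangian of a $k$-uniform hypergraph $H$ is $$\lambda(H)=\max\left\{\sum_{\{j_1,\ldots,j_k\}\in E(H)}x_{j_1}\cdots x_{j_k}:\ \sum_{i\in V(H)}x_i=1,\ x\in\mathbb{R}_{+}^{|V(H)|}\right\},$$ where $\mathbb{R}_+^n$ denotes the nonnegative real vectors and the sum is over edges. The Lagrangian density of a $k$-uniform hypergraph $F$ is $\pi_\lambda(F)=\sup\{k!\,\lambda(H): H \text{ is } k\text{-uniform and } F\text{-free}\}$. For a $k$-uniform hypergraph $F$, $K_1\ast F$ is the $(k+1)$-uniform hypergraph with vertex set $V(F)\cup\{x\}$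 (with $x\notin V(F)$ a new vertex) and edge set $\{\{x,u_1,\ldots,u_k\}:\{u_1,\ldots,u_k\}\in E(F)\}$. *)

theory Defs
  imports "HOL-Analysis.Analysis"
begin

section \<open>Hypergraphs\<close>

datatype 'a hypergraph = Hypergraph (hverts: "'a set") (hedges: "'a set set")

definition uniform_hypergraph :: "nat \<Rightarrow> 'a hypergraph \<Rightarrow> bool" where
  "uniform_hypergraph k H \<longleftrightarrow>
     finite (hverts H) \<and> (\<forall>e\<in>hedges H. e \<subseteq> hverts H \<and> card e = k)"

definition subhypergraph :: "'a hypergraph \<Rightarrow> 'a hypergraph \<Rightarrow> bool" where
  "subhypergraph H0 H \<longleftrightarrow> hverts H0 \<subseteq> hverts H \<and> hedges H0 \<subseteq> hedges H"

definition hypergraph_iso :: "'a hypergraph \<Rightarrow> 'b hypergraph \<Rightarrow> bool" where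
  "hypergraph_iso F G \<longleftrightarrow>
     (\<exists>f. bij_betw f (hverts F) (hverts G) \<and> hedges G = (\<lambda>e. f ` e) ` hedges F)"

definition contains_copy :: "'a hypergraph \<Rightarrow> 'b hypergraph \<Rightarrow> bool" where
  "contains_copy H F \<longleftrightarrow> (\<exists>H0. subhypergraph H0 H \<and> hypergraph_iso F H0)"

definition two_section :: "'a hypergraph \<Rightarrow> 'a hypergraph" where
  "two_section H = Hypergraph (hverts H)
     {{u, v} | u v. u \<in> hverts H \<and> v \<in> hverts H \<and> u \<noteq> v \<and> (\<exists>e\<in>hedges H. {u, v} \<subseteq> e)}"

definition graph_nbrs :: "'a hypergraph \<Rightarrow> 'a \<Rightarrow> 'a set" where
  "graph_nbrs G u = {v \<in> hverts G. {u, v} \<in> hedges G}"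

definition graph_max_degree :: "'a hypergraph \<Rightarrow> nat" where
  "graph_max_degree G = Max ((\<lambda>u. card (graph_nbrs G u)) ` hverts G)"

definition vertex_link :: "'a hypergraph \<Rightarrow> 'a \<Rightarrow> 'a hypergraph" where
  "vertex_link H u = Hypergraph (graph_nbrs (two_section H) u)
     {e - {u} | e. e \<in> hedges H \<and> u \<in> e}"

text \<open>\<open>K\<^sub>1 * F\<close>; the new vertex is \<^const>\<open>None\<close>.\<close>

definition K1_join :: "'a hypergraph \<Rightarrow> 'a option hypergraph" where
  "K1_join F = Hypergraph (insert None (Some ` hverts F))
     ((\<lambda>e. insert None (Some ` e)) ` hedges F)"

section \<open>Tensors and spectral radii\<close>

text \<open>A tensor of order \<open>m\<close> with indices in a finite set \<open>V\<close> is a function on index lists, of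
  which only the values on lists over \<open>V\<close> of length \<open>m\<close> matter. Likewise a vector is a function
  of which only the values on \<open>V\<close> matter.\<close>

definition tensor_apply ::
    "'a set \<Rightarrow> nat \<Rightarrow> ('a list \<Rightarrow> complex) \<Rightarrow> ('a \<Rightarrow> complex) \<Rightarrow> 'a \<Rightarrow> complex" where
  "tensor_apply V m A x i =
     (\<Sum>js \<in> {js. set js \<subseteq> V \<and> length js = m - 1}. A (i # js) * prod_list (map x js))"

definition tensor_eigenvalue :: "'a set \<Rightarrow> nat \<Rightarrow> ('a list \<Rightarrow> complex) \<Rightarrow> complex \<Rightarrow> bool" where
  "tensor_eigenvalue V m A \<mu> \<longleftrightarrow>
     (\<exists>x. (\<exists>i\<in>V. x i \<noteq> 0) \<and> (\<forall>i\<in>V. tensor_apply V m A x i = \<mu> * x i ^ (m - 1)))"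

text \<open>The supremum is attained: normalising eigenvectors shows that the set of eigenvalues is
  compact.\<close>

definition tensor_spectral_radius :: "'a set \<Rightarrow> nat \<Rightarrow> ('a list \<Rightarrow> complex) \<Rightarrow> real" where
  "tensor_spectral_radius V m A = Sup {cmod \<mu> | \<mu>. tensor_eigenvalue V m A \<mu>}"

definition adjacency_tensor :: "nat \<Rightarrow> 'a hypergraph \<Rightarrow> 'a list \<Rightarrow> complex" where
  "adjacency_tensor k H is = (if set is \<in> hedges H then 1 / fact (k - 1) else 0)"

text \<open>The uniformity \<open>k\<close> is an explicit argument because it is not determined by a hypergraph
  without edges. The spectral radius of the adjacency matrix of a graph is the case \<open>k = 2\<close>;
  see \<open>tensor_apply_order_2\<close> and \<open>adjacency_tensor_order_2\<close> below.\<close>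

definition hypergraph_rho :: "nat \<Rightarrow> 'a hypergraph \<Rightarrow> real" where
  "hypergraph_rho k H = tensor_spectral_radius (hverts H) k (adjacency_tensor k H)"

lemma tensor_apply_order_2: "tensor_apply V 2 A x i = (\<Sum>j\<in>V. A [i, j] * x j)"
proof -
  have "{js. set js \<subseteq> V \<and> length js = 2 - 1} = (\<lambda>j. [j]) ` V"
    by (auto simp: length_Suc_conv)
  then show ?thesis
    by (simp add: tensor_apply_def sum.reindex inj_on_def)
qed

lemma adjacency_tensor_order_2:
  "adjacency_tensor 2 G [i, j] = (if {i, j} \<in> hedges G then 1 else 0)"
  by (simp add: adjacency_tensor_def)

section \<open>Lagrangians\<close>

text \<open>If \<open>H\<close> has a vertex, the supremum is a maximum, since the simplex is compact. Over no
  vertices the simplex is empty, and we let the Lagrangian be 0.\<close>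

definition lagrangian :: "'a hypergraph \<Rightarrow> real" where
  "lagrangian H =
     (if hverts H = {} then 0
      else Sup {(\<Sum>e\<in>hedges H. \<Prod>j\<in>e. x j) | x.
                  (\<forall>i\<in>hverts H. 0 \<le> x i) \<and> (\<Sum>i\<in>hverts H. x i) = 1})"

text \<open>Up to isomorphism, every finite hypergraph has its vertices in \<^typ>\<open>nat\<close>.\<close>

definition lagrangian_density :: "nat \<Rightarrow> 'a hypergraph \<Rightarrow> real" where
  "lagrangian_density k F =
     Sup {fact k * lagrangian H | H :: nat hypergraph.
            uniform_hypergraph k H \<and> \<not> contains_copy H F}"

end

theory Submission
  imports Defs "HOL-Combinatorics.Multiset_Permutations"
begin

text \<open>Let \<open>x\<close> be an eigenvector of \<open>H\<close> for \<open>\<mu>\<close>, put \<open>y = \<bar>x\<bar>\<close>, and let \<open>A\<close> be the adjacency matrix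
  of the 2-section. The eigenvalue equation at \<open>i\<close> only involves the link \<open>H(i)\<close>, so by homogeneity
  of the Lagrangian \<open>\<bar>\<mu>\<bar> y\<^sub>i\<^sup>r\<^sup>-\<^sup>1 \<le> \<lambda>(H(i)) (A y)\<^sub>i\<^sup>r\<^sup>-\<^sup>1\<close>. Bounding \<open>\<lambda>(H(i))\<close> by its maximum
  over \<open>i\<close>, taking roots and pairing with \<open>y\<close> leaves the Rayleigh quotient of \<open>A\<close>, which is at most
  \<open>\<rho>(H\<^sup>(\<^sup>2\<^sup>))\<close>. That last bound, and \<open>r \<bar>E(H)\<bar> \<le> \<rho>(H) \<bar>V(H)\<bar>\<close> for (2), are two cases of one fact:
  a maximizer of the edge polynomial over nonnegative vectors with \<open>\<Sum>x\<^sub>i\<^sup>k = 1\<close> is an eigenvector.\<close>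

section \<open>Edge polynomials and their partial derivatives\<close>

abbreviation edge_sum :: "'a hypergraph \<Rightarrow> ('a \<Rightarrow> 'c::comm_semiring_1) \<Rightarrow> 'c" where
  "edge_sum H x \<equiv> \<Sum>e\<in>hedges H. \<Prod>j\<in>e. x j"

text \<open>The partial derivative of \<open>edge_sum H\<close> in coordinate \<open>i\<close>. The
  value type is left general because eigenvectors are complex, while Lagrangians and the
  maximization below use real vectors.\<close>

abbreviation link_sum :: "'a hypergraph \<Rightarrow> ('a \<Rightarrow> 'c::comm_semiring_1) \<Rightarrow> 'a \<Rightarrow> 'c" where
  "link_sum H x i \<equiv> \<Sum>e\<in>{e \<in> hedges H. i \<in> e}. \<Prod>j\<in>e - {i}. x j"

lemma uniform_hypergraphD:
  assumes "uniform_hypergraph k H"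
  shows "finite (hverts H)" "finite (hedges H)"
    and "\<And>e. e \<in> hedges H \<Longrightarrow> e \<subseteq> hverts H"
    and "\<And>e. e \<in> hedges H \<Longrightarrow> card e = k"
    and "\<And>e. e \<in> hedges H \<Longrightarrow> finite e"
proof -
  have "hedges H \<subseteq> Pow (hverts H)"
    using assms by (auto simp: uniform_hypergraph_def)
  then show "finite (hedges H)"
    using assms finite_subset[of _ "Pow (hverts H)"] by (auto simp: uniform_hypergraph_def)
qed (use assms finite_subset in \<open>auto simp: uniform_hypergraph_def\<close>)

section \<open>Lagrangians\<close>

text \<open>Summing over all subsets expands the product of the factors \<open>x i + 1\<close>, and
  \<open>1 + t \<le> exp t\<close>. On the simplex this gives the bound \<open>exp 1\<close>, the
  same for every hypergraph, so the supremum in \<open>lagrangian_density\<close> is over a bounded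
  set as well.\<close>

lemma sum_prod_subsets_le_exp:
  fixes x :: "'a \<Rightarrow> real"
  assumes "finite V" "\<A> \<subseteq> Pow V" "\<And>i. i \<in> V \<Longrightarrow> 0 \<le> x i"
  shows "(\<Sum>e\<in>\<A>. \<Prod>j\<in>e. x j) \<le> exp (\<Sum>i\<in>V. x i)"
proof -
  have "(\<Sum>e\<in>\<A>. \<Prod>j\<in>e. x j) \<le> (\<Sum>e\<in>Pow V. \<Prod>j\<in>e. x j)"
    using assms by (intro sum_mono2) (auto intro!: prod_nonneg)
  also have "\<dots> = (\<Prod>i\<in>V. x i + 1)"
    using assms(1) by (simp add: prod_add)
  also have "\<dots> \<le> (\<Prod>i\<in>V. exp (x i))"
    using assms by (intro prod_mono) (auto simp: add.commute)
  also have "\<dots> = exp (\<Sum>i\<in>V. x i)"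
    by (simp add: exp_sum assms(1))
  finally show ?thesis .
qed

context
  fixes k :: nat and H :: "'a hypergraph"
  assumes uniform: "uniform_hypergraph k H"
begin

lemma edge_sum_le_exp:
  fixes x :: "'a \<Rightarrow> real"
  assumes "\<And>i. i \<in> hverts H \<Longrightarrow> 0 \<le> x i" "(\<Sum>i\<in>hverts H. x i) = 1"
  shows "edge_sum H x \<le> exp 1"
proof -
  have "hedges H \<subseteq> Pow (hverts H)"
    using uniform_hypergraphD(3)[OF uniform] by blast
  then have "edge_sum H x \<le> exp (\<Sum>i\<in>hverts H. x i)"
    using uniform_hypergraphD(1)[OF uniform] assms(1) by (intro sum_prod_subsets_le_exp)
  then show ?thesis
    unfolding assms(2) .
qed

lemma bdd_above_lagrangian:
  "bdd_above {edge_sum H x :: real | x. (\<forall>i\<in>hverts H. 0 \<le> x i) \<and> (\<Sum>i\<in>hverts H. x i) = 1}"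
proof (rule bdd_aboveI)
  fix c :: real
  assume "c \<in> {edge_sum H x | x. (\<forall>i\<in>hverts H. 0 \<le> x i) \<and> (\<Sum>i\<in>hverts H. x i) = 1}"
  then obtain x where x: "c = edge_sum H x" "\<And>i. i \<in> hverts H \<Longrightarrow> 0 \<le> x i"
      "(\<Sum>i\<in>hverts H. x i) = 1"
    by blast
  show "c \<le> exp 1"
    using edge_sum_le_exp[OF x(2,3)] x(1) by simp
qed

lemma lagrangian_nonempty:
  assumes "hverts H \<noteq> {}"
  shows "{edge_sum H x :: real | x. (\<forall>i\<in>hverts H. 0 \<le> x i) \<and> (\<Sum>i\<in>hverts H. x i) = 1} \<noteq> {}"
proof -
  have "(\<Sum>i\<in>hverts H. 1 / card (hverts H)) = (1::real)"
    using assms uniform_hypergraphD(1)[OF uniform] by simp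
  then show ?thesis
    by (smt (verit) Collect_empty_eq divide_nonneg_nonneg of_nat_0_le_iff)
qed

lemma edge_sum_le_lagrangian:
  fixes x :: "'a \<Rightarrow> real"
  assumes "\<And>i. i \<in> hverts H \<Longrightarrow> 0 \<le> x i" "(\<Sum>i\<in>hverts H. x i) = 1"
  shows "edge_sum H x \<le> lagrangian H"
proof -
  have "hverts H \<noteq> {}"
    using assms(2) by auto
  then show ?thesis
    unfolding lagrangian_def using assms by (auto intro!: cSup_upper bdd_above_lagrangian)
qed

text \<open>The assumption \<open>0 \<le> c\<close> serves the case without vertices, where the
  Lagrangian is 0 by convention.\<close>

lemma lagrangian_le:
  assumes "0 \<le> c"
    and "\<And>x. \<lbrakk>\<And>i. i \<in> hverts H \<Longrightarrow> 0 \<le> x i; (\<Sum>i\<in>hverts H. x i) = 1\<rbrakk> \<Longrightarrow> edge_sum H x \<le> c"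
  shows "lagrangian H \<le> c"
proof (cases "hverts H = {}")
  case True
  then show ?thesis using assms(1) by (simp add: lagrangian_def)
next
  case False
  have "Sup {edge_sum H x :: real | x.
      (\<forall>i\<in>hverts H. 0 \<le> x i) \<and> (\<Sum>i\<in>hverts H. x i) = 1} \<le> c"
    using lagrangian_nonempty[OF False] assms(2) by (intro cSup_least) auto
  then show ?thesis
    using False by (simp add: lagrangian_def)
qed

lemma lagrangian_le_exp: "lagrangian H \<le> exp 1"
  by (rule lagrangian_le) (auto intro: edge_sum_le_exp)

lemma lagrangian_nonneg: "0 \<le> lagrangian H"
proof (cases "hverts H = {}")
  case True
  then show ?thesis by (simp add: lagrangian_def)
next
  case False
  then obtain x :: "'a \<Rightarrow> real"
    where x: "\<And>i. i \<in> hverts H \<Longrightarrow> 0 \<le> x i" "(\<Sum>i\<in>hverts H. x i) = 1"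
    using lagrangian_nonempty by blast
  then have "0 \<le> edge_sum H x"
    using uniform_hypergraphD(3)[OF uniform] by (intro sum_nonneg prod_nonneg) blast
  also have "\<dots> \<le> lagrangian H"
    using x by (rule edge_sum_le_lagrangian)
  finally show ?thesis .
qed

lemma edge_sum_scale:
  fixes x :: "'a \<Rightarrow> real"
  shows "edge_sum H (\<lambda>i. c * x i) = c ^ k * edge_sum H x"
  using uniform_hypergraphD(4)[OF uniform]
  by (simp add: prod.distrib sum_distrib_left cong: sum.cong)

lemma edge_sum_eq_0:
  fixes x :: "'a \<Rightarrow> real"
  assumes "0 < k" "\<And>i. i \<in> hverts H \<Longrightarrow> x i = 0"
  shows "edge_sum H x = 0"
proof (intro sum.neutral ballI)
  fix e assume "e \<in> hedges H"
  then have e: "e \<subseteq> hverts H" "card e = k" "finite e"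
    using uniform_hypergraphD[OF uniform] by auto
  then obtain j where "j \<in> e"
    using assms(1) by fastforce
  then show "(\<Prod>j\<in>e. x j) = 0"
    using assms(2) e by (metis prod_zero subsetD)
qed

text \<open>By homogeneity of degree \<open>k\<close>, dividing \<open>x\<close> by its sum reduces
  this to the simplex. If the sum is 0, then \<open>x\<close> vanishes on the vertices, and so does
  every edge product, edges being nonempty by \<open>0 < k\<close>.\<close>

lemma edge_sum_le_lagrangian_power:
  fixes x :: "'a \<Rightarrow> real"
  assumes "0 < k" "\<And>i. i \<in> hverts H \<Longrightarrow> 0 \<le> x i"
  shows "edge_sum H x \<le> lagrangian H * (\<Sum>i\<in>hverts H. x i) ^ k"
proof -
  define s where "s = (\<Sum>i\<in>hverts H. x i)"
  have "0 \<le> s"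
    unfolding s_def using assms(2) by (rule sum_nonneg)
  show ?thesis
  proof (cases "s = 0")
    case True
    then have "x i = 0" if "i \<in> hverts H" for i
      using that assms(2) uniform_hypergraphD(1)[OF uniform]
      by (simp add: s_def sum_nonneg_eq_0_iff)
    then have "edge_sum H x = 0"
      using assms(1) edge_sum_eq_0 by blast
    then show ?thesis
      using \<open>0 \<le> s\<close> by (simp add: s_def lagrangian_nonneg)
  next
    case False
    have "(\<Sum>i\<in>hverts H. inverse s * x i) = 1"
      using False by (simp flip: sum_distrib_left add: s_def[symmetric])
    then have "edge_sum H (\<lambda>i. inverse s * x i) \<le> lagrangian H"
      using assms(2) \<open>0 \<le> s\<close> by (intro edge_sum_le_lagrangian) auto
    then have "inverse s ^ k * edge_sum H x \<le> lagrangian H"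
      by (simp only: edge_sum_scale)
    then show ?thesis
      using False \<open>0 \<le> s\<close> by (simp add: s_def[symmetric] field_simps)
  qed
qed

section \<open>The spectral radius of a uniform hypergraph\<close>

text \<open>A list \<open>js\<close> contributes only if \<open>i # js\<close> lists an edge. That
  edge has as many elements as the list has entries, so there is no repetition and \<open>js\<close>
  is one of the \<open>(k - 1)!\<close> orderings of \<open>e - {i}\<close>. Their number cancels
  the entry \<open>1 / fact (k - 1)\<close>.\<close>

lemma tensor_apply_adjacency:
  assumes "0 < k" "i \<in> hverts H"
  shows "tensor_apply (hverts H) k (adjacency_tensor k H) x i = link_sum H x i"
proof -
  let ?V = "hverts H" and ?E = "{e \<in> hedges H. i \<in> e}"
  let ?L = "{js. set js \<subseteq> ?V \<and> length js = k - 1}"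
  let ?g = "\<lambda>js. 1 / fact (k - 1) * prod_list (map x js) :: complex"
  note H = uniform_hypergraphD[OF uniform]
  have eq: "{js \<in> ?L. set (i # js) \<in> hedges H} = (\<Union>e\<in>?E. permutations_of_set (e - {i}))"
    (is "?A = ?B")
  proof (intro set_eqI iffI)
    fix js assume js: "js \<in> ?A"
    then have "card (set (i # js)) = length (i # js)"
      using H(4)[of "set (i # js)"] assms(1) by simp
    then have "distinct (i # js)"
      by (rule card_distinct)
    then have "js \<in> permutations_of_set (set (i # js) - {i})"
      by (auto simp: permutations_of_set_def)
    then show "js \<in> ?B"
      using js by (intro UN_I[of "set (i # js)"]) auto
  next
    fix js assume "js \<in> ?B"
    then obtain e where e: "e \<in> hedges H" "i \<in> e" "set js = e - {i}" "distinct js"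
      by (auto simp: permutations_of_set_def)
    then have "length js = k - 1"
      using H(4,5)[of e] distinct_card[of js] by simp
    moreover have "set (i # js) = e"
      using e by auto
    ultimately show "js \<in> ?A"
      using e H(3)[of e] by auto
  qed
  have "tensor_apply ?V k (adjacency_tensor k H) x i
      = (\<Sum>js\<in>?L. if set (i # js) \<in> hedges H then ?g js else 0)"
    unfolding tensor_apply_def adjacency_tensor_def by (intro sum.cong) auto
  also have "\<dots> = (\<Sum>js\<in>{js \<in> ?L. set (i # js) \<in> hedges H}. ?g js)"
    using finite_lists_length_eq[OF H(1)] by (intro sum.inter_filter[symmetric]) auto
  also have "\<dots> = (\<Sum>e\<in>?E. \<Sum>js\<in>permutations_of_set (e - {i}). ?g js)"
    unfolding eq
  proof (intro sum.UNION_disjoint ballI impI)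
    fix e f assume "e \<in> ?E" "f \<in> ?E" "e \<noteq> f"
    then have "e - {i} \<noteq> f - {i}" by blast
    then show "permutations_of_set (e - {i}) \<inter> permutations_of_set (f - {i}) = {}"
      by (auto simp: permutations_of_set_def)
  qed (use H(2) in auto)
  also have "\<dots> = link_sum H x i"
  proof (intro sum.cong refl)
    fix e assume e: "e \<in> ?E"
    then have fin: "finite (e - {i})" and card: "card (e - {i}) = k - 1"
      using H(4,5)[of e] by auto
    have "(\<Sum>js\<in>permutations_of_set (e - {i}). ?g js)
        = (\<Sum>js\<in>permutations_of_set (e - {i}). 1 / fact (k - 1) * (\<Prod>j\<in>e - {i}. x j))"
    proof (intro sum.cong refl)
      fix js assume "js \<in> permutations_of_set (e - {i})"
      then have js: "set js = e - {i}" "distinct js"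
        by (auto simp: permutations_of_set_def)
      show "?g js = 1 / fact (k - 1) * (\<Prod>j\<in>e - {i}. x j)"
        using prod.distinct_set_conv_list[OF js(2), of x] unfolding js(1) by simp
    qed
    also have "\<dots> = (\<Prod>j\<in>e - {i}. x j)"
      using fin card by simp
    finally show "(\<Sum>js\<in>permutations_of_set (e - {i}). ?g js) = (\<Prod>j\<in>e - {i}. x j)" .
  qed
  finally show ?thesis .
qed

lemma tensor_eigenvalue_adjacency_iff:
  assumes "0 < k"
  shows "tensor_eigenvalue (hverts H) k (adjacency_tensor k H) \<mu> \<longleftrightarrow>
    (\<exists>x. (\<exists>i\<in>hverts H. x i \<noteq> 0) \<and> (\<forall>i\<in>hverts H. link_sum H x i = \<mu> * x i ^ (k - 1)))"
  unfolding tensor_eigenvalue_def using tensor_apply_adjacency[OF assms] by simp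

text \<open>Take the eigenvalue equation at a vertex where the eigenvector has maximal modulus
  \<open>M\<close>: each edge there contributes at most \<open>M ^ (k - 1)\<close>. This bounds the
  set whose supremum is the spectral radius, and for graphs it also gives the maximum degree
  bound.\<close>

lemma norm_eigenvalue_le_degree:
  assumes "0 < k" "tensor_eigenvalue (hverts H) k (adjacency_tensor k H) \<mu>"
  shows "\<exists>i\<in>hverts H. cmod \<mu> \<le> card {e \<in> hedges H. i \<in> e}"
proof -
  note H = uniform_hypergraphD[OF uniform]
  obtain x where x: "\<exists>i\<in>hverts H. x i \<noteq> 0"
      "\<And>i. i \<in> hverts H \<Longrightarrow> link_sum H x i = \<mu> * x i ^ (k - 1)"
    using assms(2) unfolding tensor_eigenvalue_adjacency_iff[OF assms(1)] by blast
  define M where "M = Max ((\<lambda>i. cmod (x i)) ` hverts H)"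
  have "M \<in> (\<lambda>i. cmod (x i)) ` hverts H"
    unfolding M_def using x(1) H(1) by (intro Max_in) auto
  then obtain i where i: "i \<in> hverts H" "cmod (x i) = M"
    by auto
  have le: "cmod (x j) \<le> M" if "j \<in> hverts H" for j
    unfolding M_def using that H(1) by simp
  have "0 < M"
    using x(1) le by (metis norm_le_zero_iff linorder_not_le order_trans)
  have "cmod \<mu> * M ^ (k - 1) = cmod (link_sum H x i)"
    using x(2)[OF i(1)] i(2) by (simp add: norm_mult norm_power)
  also have "\<dots> \<le> (\<Sum>e\<in>{e \<in> hedges H. i \<in> e}. M ^ (k - 1))"
  proof (rule sum_norm_le)
    fix e assume "e \<in> {e \<in> hedges H. i \<in> e}"
    then have e: "e \<subseteq> hverts H" "card (e - {i}) = k - 1"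
      using H(3,4,5)[of e] by auto
    have "norm (\<Prod>j\<in>e - {i}. x j) = (\<Prod>j\<in>e - {i}. norm (x j))"
      by (simp add: prod_norm)
    also have "\<dots> \<le> (\<Prod>j\<in>e - {i}. M)"
      using e le by (intro prod_mono) auto
    finally show "norm (\<Prod>j\<in>e - {i}. x j) \<le> M ^ (k - 1)"
      using e by simp
  qed
  finally have "cmod \<mu> * M ^ (k - 1) \<le> card {e \<in> hedges H. i \<in> e} * M ^ (k - 1)"
    by simp
  then have "cmod \<mu> \<le> card {e \<in> hedges H. i \<in> e}"
    using \<open>0 < M\<close> by (simp add: mult_le_cancel_right)
  then show ?thesis
    using i(1) by blast
qed

lemma bdd_above_eigenvalues:
  assumes "0 < k"
  shows "bdd_above {cmod \<mu> | \<mu>. tensor_eigenvalue (hverts H) k (adjacency_tensor k H) \<mu>}"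
proof (rule bdd_aboveI)
  fix c assume "c \<in> {cmod \<mu> | \<mu>. tensor_eigenvalue (hverts H) k (adjacency_tensor k H) \<mu>}"
  then obtain \<mu> i where *: "c = cmod \<mu>" "cmod \<mu> \<le> card {e \<in> hedges H. i \<in> e}"
    using norm_eigenvalue_le_degree[OF assms] by blast
  moreover have "card {e \<in> hedges H. i \<in> e} \<le> card (hedges H)"
    using uniform_hypergraphD(2)[OF uniform] by (intro card_mono) auto
  ultimately show "c \<le> card (hedges H)"
    by linarith
qed

lemma norm_eigenvalue_le_rho:
  assumes "0 < k" "tensor_eigenvalue (hverts H) k (adjacency_tensor k H) \<mu>"
  shows "cmod \<mu> \<le> hypergraph_rho k H"
  unfolding hypergraph_rho_def tensor_spectral_radius_def
  using assms by (intro cSup_upper bdd_above_eigenvalues) auto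

text \<open>Euler's identity for homogeneous polynomials, by double counting: the product over
  \<open>e\<close> appears once for each of the \<open>k\<close> vertices of
  \<open>e\<close>.\<close>

lemma sum_link_sum:
  fixes x :: "'a \<Rightarrow> real"
  shows "(\<Sum>i\<in>hverts H. x i * link_sum H x i) = real k * edge_sum H x"
proof -
  note H = uniform_hypergraphD[OF uniform]
  have "(\<Sum>i\<in>hverts H. x i * link_sum H x i)
      = (\<Sum>i\<in>hverts H. \<Sum>e\<in>{e \<in> hedges H. i \<in> e}. \<Prod>j\<in>e. x j)"
    unfolding sum_distrib_left using H(5) by (intro sum.cong refl) (auto simp: prod.remove)
  also have "\<dots> = (\<Sum>e\<in>hedges H. \<Sum>i\<in>{i \<in> hverts H. i \<in> e}. \<Prod>j\<in>e. x j)"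
    using H(1,2) by (rule sum.swap_restrict)
  also have "\<dots> = (\<Sum>e\<in>hedges H. real k * (\<Prod>j\<in>e. x j))"
  proof (intro sum.cong refl)
    fix e assume e: "e \<in> hedges H"
    then have "{i \<in> hverts H. i \<in> e} = e"
      using H(3) by blast
    then show "(\<Sum>i\<in>{i \<in> hverts H. i \<in> e}. \<Prod>j\<in>e. x j) = real k * (\<Prod>j\<in>e. x j)"
      using H(4)[OF e] by simp
  qed
  finally show ?thesis
    by (simp add: sum_distrib_left)
qed

text \<open>The edge polynomial is affine in each coordinate, since an edge contains a vertex at
  most once.\<close>

lemma edge_sum_fun_upd:
  fixes x :: "'a \<Rightarrow> real"
  shows "edge_sum H (x(i := t)) = t * link_sum H x i + (\<Sum>e\<in>{e \<in> hedges H. i \<notin> e}. \<Prod>j\<in>e. x j)"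
proof -
  note H = uniform_hypergraphD[OF uniform]
  have "edge_sum H (x(i := t)) = (\<Sum>e\<in>{e \<in> hedges H. i \<in> e}. \<Prod>j\<in>e. (x(i := t)) j)
      + (\<Sum>e\<in>{e \<in> hedges H. i \<notin> e}. \<Prod>j\<in>e. (x(i := t)) j)"
    using H(2) by (subst sum.union_disjoint[symmetric]) (auto intro!: sum.cong)
  also have "(\<Sum>e\<in>{e \<in> hedges H. i \<in> e}. \<Prod>j\<in>e. (x(i := t)) j) = t * link_sum H x i"
    unfolding sum_distrib_left using H(5)
    by (intro sum.cong refl) (auto simp: prod.remove intro!: prod.cong)
  also have "(\<Sum>e\<in>{e \<in> hedges H. i \<notin> e}. \<Prod>j\<in>e. (x(i := t)) j)
      = (\<Sum>e\<in>{e \<in> hedges H. i \<notin> e}. \<Prod>j\<in>e. x j)"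
    by (intro sum.cong prod.cong refl) auto
  finally show ?thesis .
qed

end

section \<open>Maximizers of the edge polynomial as eigenvectors\<close>

lemma compact_box_fun: "compact {x :: 'a \<Rightarrow> real. \<forall>i. x i \<in> (if i \<in> V then {0..1} else {0})}"
proof -
  let ?S = "\<lambda>i. if i \<in> V then {0..1} else {0::real}"
  have "compactin (product_topology (\<lambda>i. euclidean) UNIV) (PiE UNIV ?S)"
    by (subst compactin_PiE) auto
  then have "compact (PiE UNIV ?S)"
    by (simp add: euclidean_product_topology)
  moreover have "PiE UNIV ?S = {x. \<forall>i. x i \<in> ?S i}"
    unfolding PiE_UNIV_domain Pi_def by simp
  ultimately show ?thesis
    by simp
qed

text \<open>Covers coordinates of a maximizer on the boundary \<open>t\<^sub>0 = 0\<close> too: there \<open>2 \<le> k\<close> forces \<open>b = 0\<close>, so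
  the eigenvalue equation holds at every vertex and not only on the support.\<close>

lemma critical_point_power_minus_linear:
  fixes b c m t0 :: real
  assumes k: "2 \<le> k" and "0 \<le> t0" "0 \<le> b"
    and nonneg: "\<And>t. 0 \<le> t \<Longrightarrow> 0 \<le> m * t ^ k - b * t + c"
    and zero: "m * t0 ^ k - b * t0 + c = 0"
  shows "real k * m * t0 ^ (k - 1) = b"
proof (cases "t0 = 0")
  case False
  let ?f = "\<lambda>t. m * t ^ k - b * t + c"
  have "(?f has_real_derivative real k * m * t0 ^ (k - 1) - b) (at t0)"
    by (auto intro!: derivative_eq_intros)
  moreover have "0 < t0"
    using False assms(2) by simp
  \<comment> \<open>The radius \<open>t0\<close> keeps \<open>t\<close> positive, so that
    \<open>nonneg\<close> applies.\<close>
  moreover have "\<forall>t. \<bar>t0 - t\<bar> < t0 \<longrightarrow> ?f t0 \<le> ?f t"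
    using nonneg zero by (auto simp: abs_less_iff)
  ultimately show ?thesis
    using DERIV_local_min by fastforce
next
  case True
  then have "c = 0"
    using zero k by (simp add: power_0_left)
  \<comment> \<open>As \<open>c = 0\<close>, dividing \<open>nonneg\<close> by \<open>t > 0\<close>
    bounds \<open>b\<close> by \<open>m * t ^ (k - 1)\<close>, which tends to 0 as \<open>t\<close>
    decreases to 0.\<close>
  have "((\<lambda>t. m * t ^ (k - 1)) \<longlongrightarrow> m * 0 ^ (k - 1)) (at_right 0)"
    by (intro tendsto_intros)
  moreover have "\<forall>\<^sub>F t in at_right 0. b \<le> m * t ^ (k - 1)"
    unfolding eventually_at_right_field
  proof (intro exI[of _ 1] conjI allI impI)
    fix t :: real assume "0 < t"
    have "t ^ k = t * t ^ (k - 1)"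
      using k by (simp flip: power_Suc)
    then have "b * t \<le> (m * t ^ (k - 1)) * t"
      using nonneg[of t] \<open>0 < t\<close> \<open>c = 0\<close> by (simp add: mult.commute mult.left_commute)
    then show "b \<le> m * t ^ (k - 1)"
      using \<open>0 < t\<close> by (simp add: mult_le_cancel_right)
  qed simp
  ultimately have "b \<le> m * 0 ^ (k - 1)"
    by (intro tendsto_lowerbound) auto
  then show ?thesis
    using True k assms(3) by (simp add: power_0_left)
qed

text \<open>Maximality is stated in homogeneous form, for all nonnegative \<open>y\<close> and not
  only for normalized ones. A single coordinate of \<open>x\<close> can then be varied freely,
  without renormalizing and without Lagrange multipliers.\<close>

lemma exists_edge_sum_maximizer:
  assumes "uniform_hypergraph k H" "0 < k" "hverts H \<noteq> {}"
  obtains x :: "'a \<Rightarrow> real" where "\<And>i. 0 \<le> x i" "(\<Sum>i\<in>hverts H. x i ^ k) = 1"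
    "\<And>y. (\<And>i. i \<in> hverts H \<Longrightarrow> 0 \<le> y i) \<Longrightarrow> edge_sum H y \<le> edge_sum H x * (\<Sum>i\<in>hverts H. y i ^ k)"
proof -
  note H = uniform_hypergraphD[OF assms(1)]
  let ?V = "hverts H"
  \<comment> \<open>Vectors are total functions on a type that may be infinite. Fixing the value 0
    off \<open>?V\<close> makes the domain a product of compact sets.\<close>
  let ?B = "{x :: 'a \<Rightarrow> real. \<forall>i. x i \<in> (if i \<in> ?V then {0..1} else {0})}"
  let ?S = "{x :: 'a \<Rightarrow> real. (\<Sum>i\<in>?V. x i ^ k) = 1}"
  have coord: "continuous_on A (\<lambda>x :: 'a \<Rightarrow> real. x i)" for i A
    by (rule continuous_on_subset[OF continuous_on_product_coordinates subset_UNIV])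
  have "closed ?S"
    by (intro closed_Collect_eq continuous_intros coord)
  then have "compact (?B \<inter> ?S)"
    using compact_box_fun by (rule compact_Int_closed[rotated])
  moreover obtain v where v: "v \<in> ?V"
    using assms(3) by blast
  have "(\<Sum>i\<in>?V. of_bool (i = v) ^ k) = (\<Sum>i\<in>?V. if i = v then 1 else 0 :: real)"
    using assms(2) by (intro sum.cong) auto
  then have "(\<lambda>i. of_bool (i = v)) \<in> ?B \<inter> ?S"
    using v H(1) by auto
  then have "?B \<inter> ?S \<noteq> {}"
    by (intro ex_in_conv[THEN iffD1] exI)
  moreover have "continuous_on (?B \<inter> ?S) (\<lambda>x. edge_sum H x)"
    by (intro continuous_intros coord)
  ultimately obtain x where x: "x \<in> ?B \<inter> ?S" and max: "\<And>y. y \<in> ?B \<inter> ?S \<Longrightarrow> edge_sum H y \<le> edge_sum H x"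
    using continuous_attains_sup[of "?B \<inter> ?S" "\<lambda>x. edge_sum H x"] by blast
  show thesis
  proof
    have "x i \<in> (if i \<in> ?V then {0..1} else {0})" for i
      using x by blast
    then show "0 \<le> x i" for i
      by (metis atLeastAtMost_iff order_refl singletonD)
    show "(\<Sum>i\<in>?V. x i ^ k) = 1"
      using x by simp
    fix y :: "'a \<Rightarrow> real" assume y: "\<And>i. i \<in> ?V \<Longrightarrow> 0 \<le> y i"
    define s where "s = (\<Sum>i\<in>?V. y i ^ k)"
    have "0 \<le> s"
      unfolding s_def using y by (simp add: sum_nonneg)
    show "edge_sum H y \<le> edge_sum H x * (\<Sum>i\<in>?V. y i ^ k)"
    proof (cases "s = 0")
      case True
      then have "y i = 0" if "i \<in> ?V" for i
        using that y H(1) assms(2) by (simp add: s_def sum_nonneg_eq_0_iff)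
      then have "edge_sum H y = 0"
        using edge_sum_eq_0[OF assms(1,2)] by blast
      then show ?thesis
        using True by (simp add: s_def)
    next
      case False
      \<comment> \<open>Dividing by \<open>root k s\<close> makes the power sum 1, and membership in
        \<open>?B\<close> requires the value 0 off \<open>?V\<close>.\<close>
      define z where "z i = (if i \<in> ?V then inverse (root k s) * y i else 0)" for i
      have root: "root k s ^ k = s" "0 < root k s"
        using \<open>0 \<le> s\<close> False assms(2) by auto
      have "(\<Sum>i\<in>?V. z i ^ k) = inverse (root k s) ^ k * s"
        unfolding s_def sum_distrib_left z_def by (intro sum.cong) (auto simp: power_mult_distrib)
      also have "\<dots> = 1"
        using root False by (simp add: power_inverse)
      finally have sum: "(\<Sum>i\<in>?V. z i ^ k) = 1" .
      have nonneg: "0 \<le> z i" for i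
        using y root by (simp add: z_def)
      have "z i \<le> 1" if "i \<in> ?V" for i
      proof -
        have "z i ^ k \<le> (\<Sum>i\<in>?V. z i ^ k)"
          using that nonneg H(1) by (intro member_le_sum) auto
        then have "z i ^ k \<le> 1 ^ k"
          using sum by simp
        then show ?thesis
          using assms(2) nonneg by (metis power_mono_iff zero_le_one)
      qed
      moreover have "z i = 0" if "i \<notin> ?V" for i
        using that by (simp add: z_def)
      ultimately have "edge_sum H z \<le> edge_sum H x"
        using sum nonneg by (intro max) auto
      moreover have "edge_sum H z = edge_sum H (\<lambda>i. inverse (root k s) * y i)"
        using H(3) by (intro sum.cong prod.cong refl) (auto simp: z_def)
      ultimately have "inverse (root k s) ^ k * edge_sum H y \<le> edge_sum H x"
        by (simp only: edge_sum_scale[OF assms(1)])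
      then have "inverse s * edge_sum H y \<le> edge_sum H x"
        using root by (simp add: power_inverse)
      then show ?thesis
        using \<open>0 \<le> s\<close> False by (simp add: s_def[symmetric] field_simps)
    qed
  qed
qed

text \<open>Both parts come from one maximizer with maximum \<open>m\<close>:
  \<open>real k * m\<close> is an eigenvalue, hence at most the spectral radius, and
  \<open>m\<close> controls all other nonnegative vectors by homogeneity. Existence of an eigenvalue
  is what lets \<open>rho_le\<close> bound the supremum from above.\<close>

lemma
  assumes "uniform_hypergraph k H" "2 \<le> k" "hverts H \<noteq> {}"
  shows exists_eigenvalue: "\<exists>\<mu>. tensor_eigenvalue (hverts H) k (adjacency_tensor k H) \<mu>"
    and edge_sum_le_rho: "\<And>y :: 'a \<Rightarrow> real. (\<And>i. i \<in> hverts H \<Longrightarrow> 0 \<le> y i) \<Longrightarrow>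
      real k * edge_sum H y \<le> hypergraph_rho k H * (\<Sum>i\<in>hverts H. y i ^ k)"
proof -
  note H = uniform_hypergraphD[OF assms(1)]
  let ?V = "hverts H"
  have "0 < k"
    using assms(2) by simp
  obtain x :: "'a \<Rightarrow> real" where x: "\<And>i. 0 \<le> x i" "(\<Sum>i\<in>?V. x i ^ k) = 1"
    and max: "\<And>y. (\<And>i. i \<in> ?V \<Longrightarrow> 0 \<le> y i) \<Longrightarrow>
      edge_sum H y \<le> edge_sum H x * (\<Sum>i\<in>?V. y i ^ k)"
    using exists_edge_sum_maximizer[OF assms(1) \<open>0 < k\<close> assms(3)] by blast
  define m where "m = edge_sum H x"
  have crit: "real k * m * x i ^ (k - 1) = link_sum H x i" if i: "i \<in> ?V" for i
  proof -
    \<comment> \<open>With all coordinates but \<open>i\<close> frozen, maximality reads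
      \<open>t * link_sum H x i + a \<le> m * (t ^ k + c)\<close> for \<open>t \<ge> 0\<close>, with
      equality at \<open>t = x i\<close>. The critical point equation there is the eigenvalue
      equation at \<open>i\<close>.\<close>
    define c where "c = (\<Sum>j\<in>?V - {i}. x j ^ k)"
    define a where "a = (\<Sum>e\<in>{e \<in> hedges H. i \<notin> e}. \<Prod>j\<in>e. x j)"
    have power_sum: "(\<Sum>j\<in>?V. (x(i := t)) j ^ k) = t ^ k + c" for t
      unfolding c_def using i H(1) by (subst sum.remove[of _ i]) (auto intro!: sum.cong)
    have edges: "edge_sum H (x(i := t)) = t * link_sum H x i + a" for t
      unfolding a_def by (rule edge_sum_fun_upd[OF assms(1)])
    show ?thesis
    proof (rule critical_point_power_minus_linear[where c = "m * c - a"])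
      show "0 \<le> link_sum H x i"
        using x(1) by (intro sum_nonneg prod_nonneg) auto
      show "0 \<le> m * t ^ k - link_sum H x i * t + (m * c - a)" if "0 \<le> t" for t
        using max[of "x(i := t)"] that x(1)
        unfolding power_sum edges m_def[symmetric] by (simp add: algebra_simps)
      have "x i ^ k + c = 1"
        using power_sum[of "x i"] x(2) by simp
      moreover have "m = x i * link_sum H x i + a"
        using edges[of "x i"] by (simp add: m_def)
      moreover have "m * x i ^ k - link_sum H x i * x i + (m * c - a)
          = m * (x i ^ k + c) - (x i * link_sum H x i + a)"
        by (simp add: algebra_simps)
      ultimately show "m * x i ^ k - link_sum H x i * x i + (m * c - a) = 0"
        by simp
    qed (use assms(2) x(1) in auto)
  qed
  have "link_sum H (\<lambda>i. complex_of_real (x i)) i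
      = complex_of_real (real k * m) * complex_of_real (x i) ^ (k - 1)" if "i \<in> ?V" for i
  proof -
    have "link_sum H (\<lambda>i. complex_of_real (x i)) i = complex_of_real (link_sum H x i)"
      by simp
    also have "\<dots> = complex_of_real (real k * m * x i ^ (k - 1))"
      by (simp only: crit[OF that])
    finally show ?thesis
      by simp
  qed
  moreover have "\<exists>i\<in>?V. complex_of_real (x i) \<noteq> 0"
  proof (rule ccontr)
    assume "\<not> ?thesis"
    then have "(\<Sum>i\<in>?V. x i ^ k) = 0"
      using \<open>0 < k\<close> by (intro sum.neutral) auto
    then show False
      using x(2) by simp
  qed
  ultimately have eig: "tensor_eigenvalue ?V k (adjacency_tensor k H) (complex_of_real (real k * m))"
    unfolding tensor_eigenvalue_adjacency_iff[OF assms(1) \<open>0 < k\<close>]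
    by (intro exI[of _ "\<lambda>i. complex_of_real (x i)"] conjI ballI)
  then show "\<exists>\<mu>. tensor_eigenvalue ?V k (adjacency_tensor k H) \<mu>"
    by blast
  have "real k * m \<le> hypergraph_rho k H"
    using norm_eigenvalue_le_rho[OF assms(1) \<open>0 < k\<close> eig] unfolding norm_of_real by linarith
  fix y :: "'a \<Rightarrow> real" assume y: "\<And>i. i \<in> ?V \<Longrightarrow> 0 \<le> y i"
  have "real k * edge_sum H y \<le> real k * (m * (\<Sum>i\<in>?V. y i ^ k))"
    using max[OF y] by (intro mult_left_mono) (auto simp: m_def)
  also have "\<dots> \<le> hypergraph_rho k H * (\<Sum>i\<in>?V. y i ^ k)"
    using mult_right_mono[OF \<open>real k * m \<le> hypergraph_rho k H\<close>, of "\<Sum>i\<in>?V. y i ^ k"] y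
    by (simp add: sum_nonneg)
  finally show "real k * edge_sum H y \<le> hypergraph_rho k H * (\<Sum>i\<in>?V. y i ^ k)" .
qed

lemma rho_le:
  assumes "uniform_hypergraph k H" "2 \<le> k" "hverts H \<noteq> {}"
    and "\<And>\<mu>. tensor_eigenvalue (hverts H) k (adjacency_tensor k H) \<mu> \<Longrightarrow> cmod \<mu> \<le> c"
  shows "hypergraph_rho k H \<le> c"
  unfolding hypergraph_rho_def tensor_spectral_radius_def
  using exists_eigenvalue[OF assms(1-3)] assms(4) by (intro cSup_least) auto

lemma rho_nonneg:
  assumes "uniform_hypergraph k H" "2 \<le> k" "hverts H \<noteq> {}"
  shows "0 \<le> hypergraph_rho k H"
  using exists_eigenvalue[OF assms] norm_eigenvalue_le_rho[OF assms(1)] assms(2)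
  by (metis norm_ge_zero not_numeral_le_zero order_trans zero_less_iff_neq_zero)

section \<open>The 2-section and the vertex links\<close>

lemma graph_incident_edges:
  assumes "uniform_hypergraph 2 G"
  shows "{e \<in> hedges G. u \<in> e} = (\<lambda>v. {u, v}) ` graph_nbrs G u"
proof (intro set_eqI iffI)
  fix e assume e: "e \<in> {e \<in> hedges G. u \<in> e}"
  then have "card e = 2" "e \<subseteq> hverts G"
    using uniform_hypergraphD[OF assms] by auto
  then obtain v where "e = {u, v}"
    using e by (auto simp: card_2_iff insert_commute)
  then show "e \<in> (\<lambda>v. {u, v}) ` graph_nbrs G u"
    using e \<open>e \<subseteq> hverts G\<close> by (auto simp: graph_nbrs_def)
qed (auto simp: graph_nbrs_def)

lemma graph_nbrs_irrefl:
  assumes "uniform_hypergraph 2 G"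
  shows "u \<notin> graph_nbrs G u"
  using uniform_hypergraphD(4)[OF assms, of "{u}"] by (auto simp: graph_nbrs_def)

lemma inj_doubleton: "inj_on (\<lambda>v. {u, v}) A"
  by (auto simp: inj_on_def doubleton_eq_iff)

lemma graph_link_sum:
  fixes x :: "'a \<Rightarrow> real"
  assumes "uniform_hypergraph 2 G"
  shows "link_sum G x u = (\<Sum>v\<in>graph_nbrs G u. x v)"
proof -
  have "link_sum G x u = (\<Sum>v\<in>graph_nbrs G u. \<Prod>j\<in>{u, v} - {u}. x j)"
    by (simp add: graph_incident_edges[OF assms] sum.reindex[OF inj_doubleton])
  also have "\<dots> = (\<Sum>v\<in>graph_nbrs G u. x v)"
  proof (intro sum.cong refl)
    fix v assume "v \<in> graph_nbrs G u"
    then have "{u, v} - {u} = {v}"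
      using graph_nbrs_irrefl[OF assms] by auto
    then show "(\<Prod>j\<in>{u, v} - {u}. x j) = x v"
      by simp
  qed
  finally show ?thesis .
qed

text \<open>In a graph, the edges at a vertex correspond to its neighbours, so the degree bound on
  eigenvalues applies directly.\<close>

lemma graph_rho_le_max_degree:
  assumes "uniform_hypergraph 2 G" "hverts G \<noteq> {}"
  shows "hypergraph_rho 2 G \<le> graph_max_degree G"
proof (rule rho_le[OF assms(1) _ assms(2)])
  fix \<mu> assume "tensor_eigenvalue (hverts G) 2 (adjacency_tensor 2 G) \<mu>"
  then obtain u where u: "u \<in> hverts G" "cmod \<mu> \<le> card {e \<in> hedges G. u \<in> e}"
    using norm_eigenvalue_le_degree[OF assms(1)] by auto
  have "card {e \<in> hedges G. u \<in> e} = card (graph_nbrs G u)"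
    by (simp add: graph_incident_edges[OF assms(1)] card_image[OF inj_doubleton])
  also have "\<dots> \<le> graph_max_degree G"
    unfolding graph_max_degree_def using u(1) uniform_hypergraphD(1)[OF assms(1)] by simp
  finally show "cmod \<mu> \<le> graph_max_degree G"
    using u(2) by linarith
qed simp

lemma uniform_two_section:
  assumes "finite (hverts H)"
  shows "uniform_hypergraph 2 (two_section H)"
  using assms by (auto simp: uniform_hypergraph_def two_section_def card_2_iff)

lemma hverts_two_section [simp]: "hverts (two_section H) = hverts H"
  by (simp add: two_section_def)

lemma graph_nbrs_two_section:
  assumes "uniform_hypergraph k H"
  shows "graph_nbrs (two_section H) u = {v. v \<noteq> u \<and> (\<exists>e\<in>hedges H. {u, v} \<subseteq> e)}"
proof -
  have "{u, v} \<in> hedges (two_section H) \<longleftrightarrow>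
      u \<in> hverts H \<and> v \<in> hverts H \<and> u \<noteq> v \<and> (\<exists>e\<in>hedges H. {u, v} \<subseteq> e)" for v
    unfolding two_section_def by (auto simp: doubleton_eq_iff)
  then show ?thesis
    unfolding graph_nbrs_def using uniform_hypergraphD(3)[OF assms] by auto
qed

lemma uniform_vertex_link:
  assumes "uniform_hypergraph k H"
  shows "uniform_hypergraph (k - 1) (vertex_link H u)"
proof -
  note H = uniform_hypergraphD[OF assms]
  have "finite (graph_nbrs (two_section H) u)"
    using H(1) by (simp add: graph_nbrs_def)
  then show ?thesis
    using H(4,5) by (auto simp: uniform_hypergraph_def vertex_link_def graph_nbrs_two_section[OF assms])
qed

text \<open>Deleting \<open>u\<close> is injective on the edges through \<open>u\<close>. This ties
  the eigenvalue equation at \<open>u\<close> to the Lagrangian of the link.\<close>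

lemma edge_sum_vertex_link: "edge_sum (vertex_link H u) x = link_sum H x u"
proof -
  have "hedges (vertex_link H u) = (\<lambda>e. e - {u}) ` {e \<in> hedges H. u \<in> e}"
    by (auto simp: vertex_link_def)
  moreover have "inj_on (\<lambda>e. e - {u}) {e \<in> hedges H. u \<in> e}"
    by (auto simp: inj_on_def)
  ultimately show ?thesis
    by (simp add: sum.reindex)
qed

section \<open>Copies\<close>

lemma contains_copy_iff:
  "contains_copy H F \<longleftrightarrow> (\<exists>f. inj_on f (hverts F) \<and> f ` hverts F \<subseteq> hverts H \<and>
     (\<forall>e\<in>hedges F. f ` e \<in> hedges H))"
proof
  assume "contains_copy H F"
  then obtain H0 f where "hverts H0 \<subseteq> hverts H" "hedges H0 \<subseteq> hedges H"
      "inj_on f (hverts F)" "f ` hverts F = hverts H0" "hedges H0 = (`) f ` hedges F"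
    unfolding contains_copy_def subhypergraph_def hypergraph_iso_def bij_betw_def by auto
  then show "\<exists>f. inj_on f (hverts F) \<and> f ` hverts F \<subseteq> hverts H \<and> (\<forall>e\<in>hedges F. f ` e \<in> hedges H)"
    by (intro exI[of _ f]) auto
next
  assume "\<exists>f. inj_on f (hverts F) \<and> f ` hverts F \<subseteq> hverts H \<and> (\<forall>e\<in>hedges F. f ` e \<in> hedges H)"
  then obtain f where f: "inj_on f (hverts F)" "f ` hverts F \<subseteq> hverts H"
      "\<forall>e\<in>hedges F. f ` e \<in> hedges H"
    by blast
  then show "contains_copy H F"
    unfolding contains_copy_def
    by (intro exI[of _ "Hypergraph (f ` hverts F) ((`) f ` hedges F)"])
      (auto simp: subhypergraph_def hypergraph_iso_def bij_betw_def intro!: exI[of _ f])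
qed

text \<open>An embedding of \<open>F\<close> into the link extends by sending the new vertex to
  \<open>u\<close>. It stays injective because \<open>u\<close> is not its own neighbour, and
  putting \<open>u\<close> back turns each edge of the link into an edge of
  \<open>H\<close>.\<close>

lemma contains_copy_K1_join:
  assumes "uniform_hypergraph k H" "u \<in> hverts H" "contains_copy (vertex_link H u) F"
  shows "contains_copy H (K1_join F)"
proof -
  obtain f where f: "inj_on f (hverts F)" "f ` hverts F \<subseteq> graph_nbrs (two_section H) u"
      "\<And>e. e \<in> hedges F \<Longrightarrow> \<exists>e'\<in>hedges H. u \<in> e' \<and> f ` e = e' - {u}"
    using assms(3) unfolding contains_copy_iff vertex_link_def by fastforce
  let ?g = "case_option u f"
  have "u \<notin> f ` hverts F"
    using f(2) by (auto simp: graph_nbrs_two_section[OF assms(1)])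
  then have "inj_on ?g (insert None (Some ` hverts F))"
    using f(1) by (auto simp: inj_on_def)
  moreover have "?g ` insert None (Some ` hverts F) \<subseteq> hverts H"
    using f(2) assms(2) by (auto simp: graph_nbrs_def image_subset_iff)
  moreover have "?g ` insert None (Some ` e) \<in> hedges H" if e: "e \<in> hedges F" for e
  proof -
    obtain e' where e': "e' \<in> hedges H" "u \<in> e'" "f ` e = e' - {u}"
      using f(3)[OF e] by blast
    have "?g ` insert None (Some ` e) = insert u (f ` e)"
      by (simp add: image_image)
    also have "\<dots> = e'"
      using e' by auto
    finally show ?thesis
      using e' by simp
  qed
  ultimately show ?thesis
    unfolding contains_copy_iff K1_join_def by (intro exI[of _ ?g]) auto
qed

section \<open>Lagrangian densities\<close>

lemma lagrangian_density_upper_nat: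
  fixes H :: "nat hypergraph"
  assumes "uniform_hypergraph k H" "\<not> contains_copy H F"
  shows "fact k * lagrangian H \<le> lagrangian_density k F"
proof -
  have "bdd_above {fact k * lagrangian H | H :: nat hypergraph.
      uniform_hypergraph k H \<and> \<not> contains_copy H F}"
    by (rule bdd_aboveI[of _ "fact k * exp 1"]) (auto simp: lagrangian_le_exp)
  then show ?thesis
    unfolding lagrangian_density_def using assms by (intro cSup_upper) auto
qed

text \<open>The density ranges over hypergraphs on \<open>nat\<close>, so \<open>H\<close> is
  transported along an injection \<open>g\<close> of its finite vertex set. The inverse
  \<open>h\<close> carries embeddings of \<open>F\<close> back to \<open>H\<close>, and weights
  \<open>x\<close> on \<open>H\<close> to weights \<open>x \<circ> h\<close> on
  \<open>H'\<close>.\<close>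

lemma lagrangian_density_upper:
  fixes H :: "'a hypergraph"
  assumes "uniform_hypergraph k H" "\<not> contains_copy H F"
  shows "fact k * lagrangian H \<le> lagrangian_density k F"
proof -
  note H = uniform_hypergraphD[OF assms(1)]
  obtain g :: "'a \<Rightarrow> nat" where g: "inj_on g (hverts H)"
    using finite_imp_inj_to_nat_seg[OF H(1)] by blast
  define h where "h = the_inv_into (hverts H) g"
  have h: "h (g i) = i" if "i \<in> hverts H" for i
    unfolding h_def using g that by (rule the_inv_into_f_f)
  have h_image: "h ` g ` e = e" if "e \<subseteq> hverts H" for e
    using that h by (force simp: image_image)
  define H' where "H' = Hypergraph (g ` hverts H) ((`) g ` hedges H)"
  have uniform': "uniform_hypergraph k H'"
    using H g
    by (auto simp: uniform_hypergraph_def H'_def card_image inj_on_subset)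
  have "\<not> contains_copy H' F"
  proof
    assume "contains_copy H' F"
    then obtain f where f: "inj_on f (hverts F)" "f ` hverts F \<subseteq> g ` hverts H"
        "\<And>e. e \<in> hedges F \<Longrightarrow> f ` e \<in> (`) g ` hedges H"
      unfolding contains_copy_iff H'_def by auto
    have "inj_on h (g ` hverts H)"
      using h by (auto simp: inj_on_def)
    then have "inj_on (h \<circ> f) (hverts F)"
      using f(1,2) comp_inj_on inj_on_subset by blast
    moreover have "(h \<circ> f) ` hverts F \<subseteq> hverts H"
      using f(2) h by (auto simp: image_subset_iff)
    moreover have "(h \<circ> f) ` e \<in> hedges H" if e: "e \<in> hedges F" for e
    proof -
      obtain e' where e': "e' \<in> hedges H" "f ` e = g ` e'"
        using f(3)[OF e] by blast
      then have "(h \<circ> f) ` e = h ` g ` e'"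
        by (metis image_comp)
      then show ?thesis
        using e'(1) h_image[OF H(3)] by simp
    qed
    ultimately show False
      using assms(2) unfolding contains_copy_iff by blast
  qed
  then have "fact k * lagrangian H' \<le> lagrangian_density k F"
    by (rule lagrangian_density_upper_nat[OF uniform'])
  moreover have "lagrangian H \<le> lagrangian H'"
  proof (rule lagrangian_le[OF assms(1) lagrangian_nonneg[OF uniform']])
    fix x :: "'a \<Rightarrow> real"
    assume x: "\<And>i. i \<in> hverts H \<Longrightarrow> 0 \<le> x i" "(\<Sum>i\<in>hverts H. x i) = 1"
    have "inj_on ((`) g) (hedges H)"
      using h_image H(3) by (metis inj_onI)
    then have "edge_sum H' (x \<circ> h) = (\<Sum>e\<in>hedges H. \<Prod>j\<in>g ` e. x (h j))"
      by (simp add: H'_def sum.reindex)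
    also have "\<dots> = edge_sum H x"
    proof (intro sum.cong refl)
      fix e assume "e \<in> hedges H"
      then have e: "e \<subseteq> hverts H"
        by (rule H(3))
      then have "(\<Prod>j\<in>g ` e. x (h j)) = (\<Prod>j\<in>e. x (h (g j)))"
        using inj_on_subset[OF g e] by (simp add: prod.reindex)
      then show "(\<Prod>j\<in>g ` e. x (h j)) = (\<Prod>j\<in>e. x j)"
        using e h by (simp add: subset_iff cong: prod.cong)
    qed
    finally have "edge_sum H' (x \<circ> h) = edge_sum H x" .
    moreover have "edge_sum H' (x \<circ> h) \<le> lagrangian H'"
    proof (rule edge_sum_le_lagrangian[OF uniform'])
      show "0 \<le> (x \<circ> h) i" if "i \<in> hverts H'" for i
        using that x(1) h by (auto simp: H'_def)
      show "(\<Sum>i\<in>hverts H'. (x \<circ> h) i) = 1"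
        using x(2) h by (simp add: H'_def sum.reindex[OF g] cong: sum.cong)
    qed
    ultimately show "edge_sum H x \<le> lagrangian H'"
      by simp
  qed
  ultimately show ?thesis
    by (meson fact_ge_zero mult_left_mono order_trans)
qed

text \<open>The hypothesis excludes the junk value \<^term>\<open>Sup {} :: real\<close>: no hypergraph omits a copy of
  the hypergraph without vertices.\<close>

lemma lagrangian_density_nonneg:
  assumes "hverts F \<noteq> {}"
  shows "0 \<le> lagrangian_density k F"
proof -
  let ?H = "Hypergraph {} {} :: nat hypergraph"
  have "uniform_hypergraph k ?H" "\<not> contains_copy ?H F"
    using assms by (auto simp: uniform_hypergraph_def contains_copy_iff)
  then have "fact k * lagrangian ?H \<le> lagrangian_density k F"
    by (rule lagrangian_density_upper_nat)
  then show ?thesis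
    by (simp add: lagrangian_def)
qed

section \<open>Comparing the spectral radii of a hypergraph and its 2-section\<close>

text \<open>The vertex \<open>u\<close> maximizes the Lagrangian of the link and is chosen before
  any eigenvalue, so one bound holds for all eigenvalues and passes to their supremum.\<close>

lemma rho_le_rho_two_section:
  assumes "3 \<le> r" "uniform_hypergraph r H" "hverts H \<noteq> {}"
  shows "\<exists>u\<in>hverts H. hypergraph_rho r H
    \<le> hypergraph_rho 2 (two_section H) ^ (r - 1) * lagrangian (vertex_link H u)"
proof -
  note H = uniform_hypergraphD[OF assms(2)]
  let ?V = "hverts H" and ?G = "two_section H"
  define \<rho> where "\<rho> = hypergraph_rho 2 ?G"
  define \<Lambda> where "\<Lambda> = Max ((\<lambda>u. lagrangian (vertex_link H u)) ` ?V)"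
  have G: "uniform_hypergraph 2 ?G"
    using H(1) by (rule uniform_two_section)
  have r: "0 < r - 1" "0 < r" "2 \<le> r"
    using assms(1) by auto
  have "\<Lambda> \<in> (\<lambda>u. lagrangian (vertex_link H u)) ` ?V"
    unfolding \<Lambda>_def using H(1) assms(3) by (intro Max_in) auto
  then obtain u where u: "u \<in> ?V" "lagrangian (vertex_link H u) = \<Lambda>"
    by auto
  have le_\<Lambda>: "lagrangian (vertex_link H i) \<le> \<Lambda>" if "i \<in> ?V" for i
    unfolding \<Lambda>_def using that H(1) by simp
  have "0 \<le> \<Lambda>"
    using u(2) lagrangian_nonneg[OF uniform_vertex_link[OF assms(2)], of u] by simp
  have "0 \<le> \<rho>"
    unfolding \<rho>_def using assms(3) by (intro rho_nonneg[OF G]) auto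
  have "hypergraph_rho r H \<le> \<rho> ^ (r - 1) * \<Lambda>"
  proof (rule rho_le[OF assms(2) r(3) assms(3)])
    fix \<mu> assume "tensor_eigenvalue ?V r (adjacency_tensor r H) \<mu>"
    then obtain x where x: "\<exists>i\<in>?V. x i \<noteq> 0"
        "\<And>i. i \<in> ?V \<Longrightarrow> link_sum H x i = \<mu> * x i ^ (r - 1)"
      unfolding tensor_eigenvalue_adjacency_iff[OF assms(2) r(2)] by blast
    define y where "y i = cmod (x i)" for i
    define s where "s i = (\<Sum>j\<in>graph_nbrs ?G i. y j)" for i
    \<comment> \<open>Roots of order \<open>r - 1\<close> turn the inequality of degree
      \<open>r - 1\<close> at each vertex into the linear \<open>a * y i \<le> b * s i\<close>,
      which can be weighted by \<open>y i\<close> and summed.\<close>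
    define a where "a = root (r - 1) (cmod \<mu>)"
    define b where "b = root (r - 1) \<Lambda>"
    have y: "0 \<le> y i" and s: "0 \<le> s i" for i
      by (auto simp: y_def s_def intro: sum_nonneg)
    have "0 \<le> b"
      using \<open>0 \<le> \<Lambda>\<close> r by (simp add: b_def)
    have pointwise: "a * y i \<le> b * s i" if i: "i \<in> ?V" for i
    proof -
      have "cmod \<mu> * y i ^ (r - 1) = cmod (link_sum H x i)"
        using x(2)[OF i] by (simp add: y_def norm_mult norm_power)
      also have "\<dots> \<le> link_sum H y i"
        unfolding y_def by (intro sum_norm_le) (simp add: prod_norm)
      \<comment> \<open>The vertices of the link are the neighbours of \<open>i\<close> in the
        2-section, so the sum of weights on the link is \<open>s i\<close>.\<close>
      also have "\<dots> \<le> lagrangian (vertex_link H i) * s i ^ (r - 1)"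
        using edge_sum_le_lagrangian_power[OF uniform_vertex_link[OF assms(2)] r(1), of i y] y
        unfolding edge_sum_vertex_link by (simp add: s_def vertex_link_def)
      also have "\<dots> \<le> \<Lambda> * s i ^ (r - 1)"
        using le_\<Lambda>[OF i] s by (intro mult_right_mono) auto
      finally have "root (r - 1) (cmod \<mu> * y i ^ (r - 1)) \<le> root (r - 1) (\<Lambda> * s i ^ (r - 1))"
        using r by simp
      then show ?thesis
        using r y s by (simp add: real_root_mult real_root_power_cancel a_def b_def)
    qed
    define q where "q = (\<Sum>i\<in>?V. y i ^ 2)"
    have "q \<noteq> 0"
      using x(1) H(1) by (auto simp: q_def y_def sum_nonneg_eq_0_iff)
    moreover have "0 \<le> q"
      by (simp add: q_def sum_nonneg)
    ultimately have "0 < q"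
      by simp
    have "a * q = (\<Sum>i\<in>?V. y i * (a * y i))"
      unfolding q_def sum_distrib_left by (intro sum.cong) (auto simp: power2_eq_square)
    also have "\<dots> \<le> (\<Sum>i\<in>?V. y i * (b * s i))"
      using pointwise y by (intro sum_mono mult_left_mono) auto
    also have "\<dots> = b * (\<Sum>i\<in>?V. y i * link_sum ?G y i)"
      unfolding sum_distrib_left s_def graph_link_sum[OF G, symmetric]
      by (intro sum.cong) auto
    also have "\<dots> = b * (2 * edge_sum ?G y)"
      using sum_link_sum[OF G, of y] by simp
    \<comment> \<open>Twice the edge polynomial of a graph is the quadratic form of its adjacency
      matrix, so \<open>edge_sum_le_rho\<close> for order 2 is the Rayleigh bound.\<close>
    also have "\<dots> \<le> b * (\<rho> * q)"
      using edge_sum_le_rho[OF G, of y] y assms(3) \<open>0 \<le> b\<close>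
      by (intro mult_left_mono) (auto simp: \<rho>_def q_def)
    finally have "a \<le> b * \<rho>"
      using \<open>0 < q\<close> by simp
    moreover have "0 \<le> a"
      using r by (simp add: a_def)
    ultimately have "a ^ (r - 1) \<le> (b * \<rho>) ^ (r - 1)"
      by (intro power_mono)
    then show "cmod \<mu> \<le> \<rho> ^ (r - 1) * \<Lambda>"
      using r \<open>0 \<le> \<Lambda>\<close> by (simp add: a_def b_def power_mult_distrib mult.commute)
  qed
  then show ?thesis
    using u unfolding \<rho>_def by auto
qed

text \<open>Test with the all-ones vector: every edge and every vertex contributes 1.\<close>

lemma average_degree_le_rho:
  assumes "uniform_hypergraph k H" "2 \<le> k" "hverts H \<noteq> {}"
  shows "real k * card (hedges H) \<le> hypergraph_rho k H * card (hverts H)"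
  using edge_sum_le_rho[OF assms, of "\<lambda>_. 1"] by simp

theorem theorem3p4:
  fixes H :: "'a hypergraph" and r :: nat
  assumes "r \<ge> 3"
    and "uniform_hypergraph r H"
    and "hedges H \<noteq> {}"
  shows "(\<exists>u\<in>hverts H.
            hypergraph_rho r H
              \<le> hypergraph_rho 2 (two_section H) ^ (r - 1) * lagrangian (vertex_link H u)) \<and>
         (\<forall>F :: 'b hypergraph.
            uniform_hypergraph (r - 1) F \<longrightarrow>
              (fact (r - 1) * hypergraph_rho r H
                 > hypergraph_rho 2 (two_section H) ^ (r - 1) * lagrangian_density (r - 1) F
               \<or> fact r * real (card (hedges H))
                 > real (card (hverts H)) * hypergraph_rho 2 (two_section H) ^ (r - 1)
                     * lagrangian_density (r - 1) F
               \<or> fact (r - 1) * hypergraph_rho r H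
                 > real (graph_max_degree (two_section H)) ^ (r - 1)
                     * lagrangian_density (r - 1) F) \<longrightarrow>
              contains_copy H (K1_join F))"
proof (intro conjI allI impI)
  note H = uniform_hypergraphD[OF assms(2)]
  let ?\<rho> = "hypergraph_rho r H" and ?\<rho>\<^sub>2 = "hypergraph_rho 2 (two_section H)"
  let ?n = "card (hverts H)" and ?\<Delta> = "graph_max_degree (two_section H)"
  obtain e where e: "e \<in> hedges H"
    using assms(3) by blast
  then have nonempty: "hverts H \<noteq> {}"
    using H(3,4)[OF e] assms(1) by auto
  have G: "uniform_hypergraph 2 (two_section H)"
    using H(1) by (rule uniform_two_section)
  have \<rho>\<^sub>2: "0 \<le> ?\<rho>\<^sub>2" "?\<rho>\<^sub>2 \<le> ?\<Delta>"
    using rho_nonneg[OF G] graph_rho_le_max_degree[OF G] nonempty by auto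
  show "\<exists>u\<in>hverts H. ?\<rho> \<le> ?\<rho>\<^sub>2 ^ (r - 1) * lagrangian (vertex_link H u)"
    using rho_le_rho_two_section[OF assms(1,2) nonempty] .
  then obtain u where u: "u \<in> hverts H" "?\<rho> \<le> ?\<rho>\<^sub>2 ^ (r - 1) * lagrangian (vertex_link H u)"
    by blast
  fix F :: "'b hypergraph"
  let ?\<pi> = "lagrangian_density (r - 1) F"
  assume F: "uniform_hypergraph (r - 1) F"
  assume "fact (r - 1) * ?\<rho> > ?\<rho>\<^sub>2 ^ (r - 1) * ?\<pi>
    \<or> fact r * real (card (hedges H)) > real ?n * ?\<rho>\<^sub>2 ^ (r - 1) * ?\<pi>
    \<or> fact (r - 1) * ?\<rho> > real ?\<Delta> ^ (r - 1) * ?\<pi>"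
  \<comment> \<open>Conditions (2) and (3) are reduced to (1). For (3), replacing the maximum degree
    by the smaller spectral radius needs a nonnegative density, which is available once
    \<open>F\<close> has a vertex; the other case is treated apart.\<close>
  then consider "fact (r - 1) * ?\<rho> > ?\<rho>\<^sub>2 ^ (r - 1) * ?\<pi>" | "hverts F = {}"
  proof (elim disjE)
    assume *: "fact r * real (card (hedges H)) > real ?n * ?\<rho>\<^sub>2 ^ (r - 1) * ?\<pi>"
    have "0 < real ?n"
      using nonempty H(1) by (simp add: card_gt_0_iff)
    have "fact r * real (card (hedges H)) = fact (r - 1) * (real r * card (hedges H))"
      using assms(1) by (simp add: fact_reduce)
    also have "\<dots> \<le> fact (r - 1) * (?\<rho> * ?n)"
      using average_degree_le_rho[OF assms(2) _ nonempty] assms(1)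
      by (intro mult_left_mono) auto
    finally have "real ?n * (?\<rho>\<^sub>2 ^ (r - 1) * ?\<pi>) < real ?n * (fact (r - 1) * ?\<rho>)"
      using * by (simp add: mult_ac)
    then show ?thesis
      using that(1) \<open>0 < real ?n\<close> by simp
  next
    assume *: "fact (r - 1) * ?\<rho> > real ?\<Delta> ^ (r - 1) * ?\<pi>"
    show ?thesis
    proof (cases "hverts F = {}")
      case False
      then have "?\<rho>\<^sub>2 ^ (r - 1) * ?\<pi> \<le> real ?\<Delta> ^ (r - 1) * ?\<pi>"
        using \<rho>\<^sub>2 by (intro mult_right_mono power_mono lagrangian_density_nonneg)
      then show ?thesis
        using * that(1) by linarith
    qed (rule that(2))
  qed (rule that(1))
  then show "contains_copy H (K1_join F)"
  proof cases
    case 1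
    also have "fact (r - 1) * ?\<rho>
        \<le> fact (r - 1) * (?\<rho>\<^sub>2 ^ (r - 1) * lagrangian (vertex_link H u))"
      using u(2) by (intro mult_left_mono) auto
    finally have "?\<rho>\<^sub>2 ^ (r - 1) * ?\<pi>
        < ?\<rho>\<^sub>2 ^ (r - 1) * (fact (r - 1) * lagrangian (vertex_link H u))"
      by (simp add: mult_ac)
    then have "?\<pi> < fact (r - 1) * lagrangian (vertex_link H u)"
      \<comment> \<open>The strict inequality excludes a zero factor, so
        \<open>0 \<le> ?\<rho>\<^sub>2\<close> is enough to cancel.\<close>
      using \<rho>\<^sub>2(1) by (auto dest: mult_left_less_imp_less)
    then have "contains_copy (vertex_link H u) F"
      using lagrangian_density_upper[OF uniform_vertex_link[OF assms(2)]] linorder_not_le by blast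
    then show ?thesis
      by (rule contains_copy_K1_join[OF assms(2) u(1)])
  next
    case 2
    \<comment> \<open>An edge would need \<open>r - 1 \<ge> 2\<close> vertices. Hence
      \<open>K1_join F\<close> is a single vertex without edges, and it can be mapped to
      \<open>u\<close>.\<close>
    then have "hedges F = {}"
      using uniform_hypergraphD(3,4)[OF F] assms(1) by fastforce
    then show ?thesis
      using 2 u(1) by (auto simp: contains_copy_iff K1_join_def)
  qed
qed

end
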